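(* Let $\mathsf{A} \in \mathcal{K}(\mathit{GL}_d(\mathbb{R}))$ be a singleton set. Then $\check{\varrho}\colon \mathcal{K}(\mathit{GL}_d(\mathbb{R}))\to\mathbb{R}_+$ is continuous at $\mathsf{A}$.
   Context: $\mathcal{K}(\mathit{GL}_d(\mathbb{R}))$ is the set of all nonempty compact subsets of $\mathit{GL}_d(\mathbb{R})$, equipped with the Hausdorff metric $d_H(\mathsf{A},\mathsf{B}) = \max\{\sup_{A\in\mathsf{A}}\inf_{B\in\mathsf{B}}\|A-B\|, \sup_{B\in\mathsf{B}}\inf_{A\in\mathsf{A}}\|A-B\|\}$, where $\|\cdot\|$ is the Euclidean operator norm. $\mathbb{R}_+=[0,\infty)$. For a nonempty compact set $\mathsf{A}$ of matrices, the lower spectral radius is $$\check{\varrho}(\mathsf{A}) := \lim_{n\to\infty} \inf\{\|A_n\cdots A_1\|^{1/n} : A_1,\dots,A_n \in \mathsf{A}\} = \inf_{n\ge 1} \inf\{\|A_n\cdots A_1\|^{1/n} : A_1,\dots,A_n \in \mathsf{A}\}.$$ *)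

theory Defs
  imports "HOL-Analysis.Analysis"
begin

definition opnorm :: "real^'n^'n \<Rightarrow> real" where
  "opnorm A = onorm ((*v) A)"

definition GL :: "(real^'n^'n) set" where
  "GL = {A. invertible A}"

text \<open>
  Compactness refers to the library topology of \<^typ>\<open>real^'n^'n\<close>, which is the one induced by
  \<^const>\<open>opnorm\<close>, although the library norm of a matrix is not its operator norm.
\<close>

definition K_GL :: "(real^'n^'n) set set" where
  "K_GL = {S. S \<noteq> {} \<and> compact S \<and> S \<subseteq> GL}"

text \<open>
  The value off \<^const>\<open>K_GL\<close> does not affect the topology; it is fixed because
  \<^locale>\<open>Metric_space\<close> demands a total non-negative distance, and suprema and infima of
  unbounded or empty sets of reals are unspecified.
\<close>

definition hausdorff_dist :: "(real^'n^'n) set \<Rightarrow> (real^'n^'n) set \<Rightarrow> real" where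
  "hausdorff_dist S T =
     (if S \<in> K_GL \<and> T \<in> K_GL
      then max (SUP A\<in>S. INF B\<in>T. opnorm (A - B)) (SUP B\<in>T. INF A\<in>S. opnorm (A - B))
      else 0)"

text \<open>\<open>matprod A n\<close> is the product $A_n \cdots A_1$.\<close>

primrec matprod :: "(nat \<Rightarrow> real^'n^'n) \<Rightarrow> nat \<Rightarrow> real^'n^'n" where
  "matprod A 0 = mat 1"
| "matprod A (Suc n) = A (Suc n) ** matprod A n"

definition min_growth :: "(real^'n^'n) set \<Rightarrow> nat \<Rightarrow> real" where
  "min_growth S n = Inf {root n (opnorm (matprod A n)) | A. \<forall>i\<in>{1..n}. A i \<in> S}"

text \<open>
  That this limit exists and equals the infimum over \<open>n \<ge> 1\<close> is proved below, in
  \<open>min_growth_tendsto\<close>.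
\<close>

definition lower_spectral_radius :: "(real^'n^'n) set \<Rightarrow> real" where
  "lower_spectral_radius S = lim (min_growth S)"


subsection \<open>The limit defining the lower spectral radius\<close>

lemma opnorm_nonneg: "0 \<le> opnorm A"
  unfolding opnorm_def by (rule onorm_pos_le) simp

lemma opnorm_mult_le: "opnorm (A ** B) \<le> opnorm A * opnorm B"
proof -
  have "(*v) (A ** B) = (*v) A \<circ> (*v) B"
    by (simp add: fun_eq_iff matrix_vector_mul_assoc)
  then show ?thesis
    unfolding opnorm_def by (simp add: onorm_compose)
qed

lemma matprod_add: "matprod A (n + k) = matprod (\<lambda>i. A (i + k)) n ** matprod A k"
  by (induction n) (simp_all add: matrix_mul_assoc)

lemma matprod_cong: "(\<And>i. i \<in> {1..n} \<Longrightarrow> A i = B i) \<Longrightarrow> matprod A n = matprod B n"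
  by (induction n) auto

lemma min_growth_le:
  "(\<And>i. i \<in> {1..n} \<Longrightarrow> A i \<in> S) \<Longrightarrow> min_growth S n \<le> root n (opnorm (matprod A n))"
  unfolding min_growth_def
  by (rule cInf_lower)
    (auto intro!: bdd_belowI[where m=0] simp: real_root_ge_zero opnorm_nonneg)

lemma min_growth_nonneg:
  assumes "S \<noteq> {}"
  shows "0 \<le> min_growth S n"
proof -
  obtain M where "M \<in> S" using assms by auto
  then have "root n (opnorm (matprod (\<lambda>_. M) n)) \<in>
      {root n (opnorm (matprod A n)) | A. \<forall>i\<in>{1..n}. A i \<in> S}"
    by auto
  then show ?thesis
    unfolding min_growth_def
    by (intro cInf_greatest) (auto simp: real_root_ge_zero opnorm_nonneg)
qed

lemma min_growth_eventually_less:
  assumes "S \<noteq> {}" "k \<ge> 1" "min_growth S k < u"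
  shows "eventually (\<lambda>n. min_growth S n < u) sequentially"
proof -
  obtain M where "M \<in> S" using assms by auto
  then have "{root k (opnorm (matprod A k)) | A. \<forall>i\<in>{1..k}. A i \<in> S} \<noteq> {}"
    by (auto intro: exI[of _ "\<lambda>_. M"])
  from cInf_lessD[OF this] assms(3) obtain W
    where W: "\<And>i. i \<in> {1..k} \<Longrightarrow> W i \<in> S" "root k (opnorm (matprod W k)) < u"
    unfolding min_growth_def by blast
  from dense[OF W(2)] obtain r where r: "root k (opnorm (matprod W k)) < r" "r < u"
    by auto
  have r0: "0 < r"
    using r(1) real_root_ge_zero[OF opnorm_nonneg] by (rule le_less_trans[rotated])
  define A where "A i = W (Suc ((i - 1) mod k))" for i
  have AS: "A i \<in> S" for i
    unfolding A_def using assms(2) by (intro W) (auto simp: Suc_le_eq)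
  have "matprod A k = matprod W k"
    by (rule matprod_cong) (auto simp: A_def)
  then have "root k (opnorm (matprod A k)) < root k (r ^ k)"
    using r r0 assms(2) by (simp add: real_root_power_cancel)
  then have Pk: "opnorm (matprod A k) < r ^ k"
    using assms(2) by simp
  have per: "matprod (\<lambda>i. A (i + k)) n = matprod A n" for n
  proof (rule matprod_cong)
    fix i assume "i \<in> {1..n}"
    then have "i + k - 1 = (i - 1) + k" by auto
    then show "A (i + k) = A i" by (simp only: A_def mod_add_self2)
  qed
  define C where "C = 1 + (\<Sum>j<k. opnorm (matprod A j) / r ^ j)"
  have nn: "0 \<le> opnorm (matprod A j) / r ^ j" for j
    using r0 by (simp add: opnorm_nonneg)
  have C: "C > 0"
    unfolding C_def using nn by (intro add_pos_nonneg sum_nonneg) auto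
  have bound: "opnorm (matprod A n) \<le> C * r ^ n" for n
  proof (induction n rule: less_induct)
    case (less n)
    show ?case
    proof (cases "n < k")
      case True
      have "opnorm (matprod A n) / r ^ n \<le> (\<Sum>j<k. opnorm (matprod A j) / r ^ j)"
        using True nn by (intro member_le_sum) auto
      then have "opnorm (matprod A n) / r ^ n \<le> C" by (simp add: C_def)
      then show ?thesis using r0 by (simp add: pos_divide_le_eq)
    next
      case False
      then have n: "n = (n - k) + k" by simp
      have "opnorm (matprod A n) \<le> opnorm (matprod A (n - k)) * opnorm (matprod A k)"
        by (subst n, subst matprod_add, subst per) (rule opnorm_mult_le)
      also have "\<dots> \<le> (C * r ^ (n - k)) * r ^ k"
        using less[of "n - k"] False assms(2) Pk C r0
        by (intro mult_mono) (auto simp: opnorm_nonneg)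
      also have "\<dots> = C * r ^ n"
        by (subst (2) n) (simp only: power_add mult.assoc)
      finally show ?thesis .
    qed
  qed
  have "(\<lambda>n. root n C * r) \<longlonglongrightarrow> 1 * r"
    using C by (intro tendsto_intros LIMSEQ_root_const)
  then have "eventually (\<lambda>n. root n C * r < u) sequentially"
    using r(2) by (intro order_tendstoD) auto
  with eventually_gt_at_top[of 0] show ?thesis
  proof eventually_elim
    case (elim n)
    have "min_growth S n \<le> root n (opnorm (matprod A n))"
      using AS by (rule min_growth_le)
    also have "\<dots> \<le> root n (C * r ^ n)"
      using bound elim by simp
    also have "\<dots> = root n C * r"
      using elim r0 by (simp add: real_root_mult real_root_power_cancel)
    finally show ?case using elim by simp
  qed
qed

lemma min_growth_tendsto:
  assumes "S \<noteq> {}"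
  shows "min_growth S \<longlonglongrightarrow> (INF n\<in>{1..}. min_growth S n)"
proof (rule order_tendstoI)
  have bdd: "bdd_below (min_growth S ` {1..})"
    using min_growth_nonneg[OF assms] by (intro bdd_belowI[where m=0]) auto
  fix a
  { assume a: "a < (INF n\<in>{1..}. min_growth S n)"
    show "eventually (\<lambda>n. a < min_growth S n) sequentially"
      using eventually_ge_at_top[of 1]
      by eventually_elim (meson a atLeast_iff bdd cINF_lower less_le_trans) }
  { assume "(INF n\<in>{1..}. min_growth S n) < a"
    then obtain k where "k \<ge> 1" "min_growth S k < a"
      using cINF_less_iff[OF _ bdd] by auto
    then show "eventually (\<lambda>n. min_growth S n < a) sequentially"
      by (rule min_growth_eventually_less[OF assms]) }
qed

lemma lower_spectral_radius_eq_INF: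
  "S \<noteq> {} \<Longrightarrow> lower_spectral_radius S = (INF n\<in>{1..}. min_growth S n)"
  unfolding lower_spectral_radius_def by (rule limI) (rule min_growth_tendsto)

lemma lower_spectral_radius_nonneg: "S \<noteq> {} \<Longrightarrow> 0 \<le> lower_spectral_radius S"
  by (auto simp: lower_spectral_radius_eq_INF intro!: cINF_greatest min_growth_nonneg)

subsection \<open>The Hausdorff metric\<close>

lemma opnorm_minus_commute: "opnorm (A - B) = opnorm (B - A)"
proof -
  have "(*v) (A - B) = (\<lambda>x. - ((B - A) *v x))"
    by (simp add: fun_eq_iff matrix_vector_mult_diff_rdistrib)
  then show ?thesis
    unfolding opnorm_def by (simp only: onorm_neg)
qed

lemma opnorm_triangle: "opnorm (A - C) \<le> opnorm (A - B) + opnorm (B - C)"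
proof -
  have "(*v) (A - C) = (\<lambda>x. (A - B) *v x + (B - C) *v x)"
    by (simp add: fun_eq_iff matrix_vector_mult_diff_rdistrib)
  then show ?thesis
    unfolding opnorm_def by (simp add: onorm_triangle)
qed

lemma norm_le_opnorm:
  fixes A :: "real^'n^'n"
  shows "norm A \<le> real CARD('n) * real CARD('n) * opnorm A"
proof -
  have "norm A \<le> (\<Sum>i\<in>UNIV. norm (A $ i))"
    by (simp add: norm_vec_def L2_set_le_sum)
  also have "\<dots> \<le> (\<Sum>i\<in>UNIV. \<Sum>j\<in>UNIV. \<bar>A $ i $ j\<bar>)"
    by (intro sum_mono norm_le_l1_cart)
  also have "\<dots> \<le> (\<Sum>i\<in>(UNIV::'n set). \<Sum>j\<in>(UNIV::'n set). opnorm A)"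
    unfolding opnorm_def by (intro sum_mono matrix_component_le_onorm)
  finally show ?thesis by (simp add: mult.assoc)
qed

lemma opnorm_le_norm:
  fixes A :: "real^'n^'n"
  shows "opnorm A \<le> real CARD('n) * real CARD('n) * norm A"
  unfolding opnorm_def
  by (rule onorm_le_matrix_component)
    (meson component_le_norm_cart Finite_Cartesian_Product.norm_nth_le order_trans)

lemma bdd_below_opnorm: "bdd_below ((\<lambda>B. opnorm (f B)) ` T)"
  by (intro bdd_belowI[where m=0]) (auto simp: opnorm_nonneg)

lemma bdd_above_INF_opnorm:
  fixes S T :: "(real^'n^'n) set"
  assumes "S \<in> K_GL" "T \<in> K_GL"
  shows "bdd_above ((\<lambda>A. INF B\<in>T. opnorm (A - B)) ` S)"
proof -
  from assms obtain B where B: "B \<in> T" by (auto simp: K_GL_def)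
  from assms obtain c where c: "\<And>A. A \<in> S \<Longrightarrow> norm A \<le> c"
    using compact_imp_bounded[of S] by (auto simp: K_GL_def bounded_iff)
  show ?thesis
  proof (rule bdd_aboveI2)
    fix A assume "A \<in> S"
    have "(INF B\<in>T. opnorm (A - B)) \<le> opnorm (A - B)"
      by (rule cINF_lower[OF bdd_below_opnorm B])
    also have "\<dots> \<le> real CARD('n) * real CARD('n) * norm (A - B)"
      by (rule opnorm_le_norm)
    also have "\<dots> \<le> real CARD('n) * real CARD('n) * (c + norm B)"
      using c[OF \<open>A \<in> S\<close>] norm_triangle_ineq4[of A B] by (intro mult_left_mono) auto
    finally show "(INF B\<in>T. opnorm (A - B)) \<le> real CARD('n) * real CARD('n) * (c + norm B)" .
  qed
qed

lemma hausdorff_dist_commute: "hausdorff_dist S T = hausdorff_dist T S"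
  by (auto simp: hausdorff_dist_def max.commute opnorm_minus_commute)

lemma hausdorff_dist_upper:
  assumes "S \<in> K_GL" "T \<in> K_GL" "A \<in> S"
  shows "(INF B\<in>T. opnorm (A - B)) \<le> hausdorff_dist S T"
  using cSUP_upper[OF assms(3) bdd_above_INF_opnorm[OF assms(1,2)]] assms
  by (simp add: hausdorff_dist_def le_max_iff_disj)

lemma hausdorff_dist_nonneg: "0 \<le> hausdorff_dist S T"
proof (cases "S \<in> K_GL \<and> T \<in> K_GL")
  case True
  then obtain A where A: "A \<in> S" by (auto simp: K_GL_def)
  have "0 \<le> (INF B\<in>T. opnorm (A - B))"
    using True by (intro cINF_greatest) (auto simp: K_GL_def opnorm_nonneg)
  also have "\<dots> \<le> hausdorff_dist S T"
    using True A by (intro hausdorff_dist_upper) auto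
  finally show ?thesis .
qed (auto simp: hausdorff_dist_def)

lemma hausdorff_dist_lessD:
  assumes "S \<in> K_GL" "T \<in> K_GL" "A \<in> S" "hausdorff_dist S T < r"
  obtains B where "B \<in> T" "opnorm (A - B) < r"
proof -
  have "(INF B\<in>T. opnorm (A - B)) < r"
    using hausdorff_dist_upper[OF assms(1-3)] assms(4) by simp
  then show thesis
    using that assms(2) by (auto simp: cINF_less_iff[OF _ bdd_below_opnorm] K_GL_def)
qed

lemma hausdorff_dist_leI:
  assumes "S \<in> K_GL" "T \<in> K_GL"
    and "\<And>A. A \<in> S \<Longrightarrow> \<exists>B\<in>T. opnorm (A - B) \<le> r"
    and "\<And>B. B \<in> T \<Longrightarrow> \<exists>A\<in>S. opnorm (A - B) \<le> r"
  shows "hausdorff_dist S T \<le> r"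
proof -
  have "(SUP A\<in>S. INF B\<in>T. opnorm (A - B)) \<le> r"
    using assms(1,3)
    by (intro cSUP_least) (auto simp: K_GL_def intro: cINF_lower2[OF bdd_below_opnorm])
  moreover have "(SUP B\<in>T. INF A\<in>S. opnorm (A - B)) \<le> r"
  proof (rule cSUP_least)
    fix B assume "B \<in> T"
    with assms(4) obtain A where "A \<in> S" "opnorm (A - B) \<le> r" by blast
    then show "(INF A\<in>S. opnorm (A - B)) \<le> r" by (rule cINF_lower2[OF bdd_below_opnorm])
  qed (use assms(2) in \<open>simp add: K_GL_def\<close>)
  ultimately show ?thesis
    using assms(1,2) by (simp add: hausdorff_dist_def)
qed

lemma hausdorff_dist_zeroD:
  fixes S T :: "(real^'n^'n) set"
  assumes "S \<in> K_GL" "T \<in> K_GL" "hausdorff_dist S T = 0"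
  shows "S \<subseteq> T"
proof
  fix A assume A: "A \<in> S"
  let ?c = "real CARD('n) * real CARD('n)"
  have "A \<in> closure T"
    unfolding closure_approachable
  proof (intro allI impI)
    fix e :: real assume "e > 0"
    then have "hausdorff_dist S T < e / ?c" using assms(3) by simp
    then obtain B where B: "B \<in> T" "opnorm (A - B) < e / ?c"
      using hausdorff_dist_lessD[OF assms(1,2) A] by blast
    have "norm (A - B) \<le> ?c * opnorm (A - B)" by (rule norm_le_opnorm)
    also have "\<dots> < e" using B(2) by (simp add: field_simps)
    finally show "\<exists>B\<in>T. dist B A < e"
      using B(1) by (auto simp: dist_norm norm_minus_commute)
  qed
  then show "A \<in> T"
    using assms(2) by (simp add: K_GL_def compact_imp_closed closure_closed)
qed

lemma Metric_space_hausdorff_dist: "Metric_space K_GL hausdorff_dist"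
proof
  fix S T U :: "(real^'a^'a) set"
  show "0 \<le> hausdorff_dist S T" by (rule hausdorff_dist_nonneg)
  show "hausdorff_dist S T = hausdorff_dist T S" by (rule hausdorff_dist_commute)
  assume S: "S \<in> K_GL" and T: "T \<in> K_GL"
  show "hausdorff_dist S T = 0 \<longleftrightarrow> S = T"
  proof
    assume "hausdorff_dist S T = 0"
    then show "S = T"
      using hausdorff_dist_zeroD[OF S T] hausdorff_dist_zeroD[OF T S]
      by (simp add: hausdorff_dist_commute)
  next
    assume "S = T"
    have "opnorm (0 :: real^'a^'a) = 0"
      by (simp add: opnorm_def onorm_eq_0)
    then have "hausdorff_dist S S \<le> 0"
      by (intro hausdorff_dist_leI S) (auto intro: bexI[rotated])
    then show "hausdorff_dist S T = 0"
      using \<open>S = T\<close> hausdorff_dist_nonneg[of S S] by simp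
  qed
  assume U: "U \<in> K_GL"
  show "hausdorff_dist S U \<le> hausdorff_dist S T + hausdorff_dist T U"
  proof (rule field_le_epsilon)
    fix e :: real assume e: "e > 0"
    have le: "\<exists>C\<in>Z. opnorm (A - C) \<le> hausdorff_dist X Y + hausdorff_dist Y Z + e"
      if X: "X \<in> K_GL" and Y: "Y \<in> K_GL" and Z: "Z \<in> K_GL" and A: "A \<in> X"
      for X Y Z :: "(real^'a^'a) set" and A
    proof -
      obtain B where B: "B \<in> Y" "opnorm (A - B) < hausdorff_dist X Y + e / 2"
        using hausdorff_dist_lessD[OF X Y A, of "hausdorff_dist X Y + e / 2"] e by auto
      obtain C where C: "C \<in> Z" "opnorm (B - C) < hausdorff_dist Y Z + e / 2"
        using hausdorff_dist_lessD[OF Y Z B(1), of "hausdorff_dist Y Z + e / 2"] e by auto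
      have "opnorm (A - C) \<le> hausdorff_dist X Y + hausdorff_dist Y Z + e"
        using opnorm_triangle[of A C B] B(2) C(2) by linarith
      then show ?thesis using C(1) by blast
    qed
    show "hausdorff_dist S U \<le> hausdorff_dist S T + hausdorff_dist T U + e"
    proof (rule hausdorff_dist_leI[OF S U])
      fix A assume "A \<in> S"
      then show "\<exists>C\<in>U. opnorm (A - C) \<le> hausdorff_dist S T + hausdorff_dist T U + e"
        by (rule le[OF S T U])
    next
      fix C assume "C \<in> U"
      from le[OF U T S this]
      show "\<exists>A\<in>S. opnorm (A - C) \<le> hausdorff_dist S T + hausdorff_dist T U + e"
        by (simp add: opnorm_minus_commute hausdorff_dist_commute add.commute)
    qed
  qed
qed

end

theory Submission
  imports Defs
begin

text \<open>
  Let \<open>S = {A}\<close>. Upper semicontinuity holds because \<^const>\<open>lower_spectral_radius\<close> is an infimum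
  over \<open>n\<close>, each term of which is at most \<open>\<parallel>B\<^sup>n\<parallel>\<^bsup>1/n\<^esup>\<close> for any \<open>B\<close> in the set, and this is
  continuous in \<open>B\<close> (\<open>lower_spectral_radius_upper_semicontinuous\<close>).

  For lower semicontinuity, let \<open>r\<close> be slightly smaller than the spectral radius of \<open>A\<close>. The task is
  to bound all products of matrices near \<open>A\<close> from below by a multiple of \<open>r\<^sup>n\<close>. An indefinite
  Lyapunov function does this, without any splitting of the space into spectral subspaces of \<open>A\<close>.
  The Stein equation \<open>A\<^sup>T Q A - r\<^sup>2 Q = I\<close> is linear in \<open>Q\<close>, and it is solvable unless \<open>r\<^sup>2\<close> is an
  eigenvalue of \<open>Q \<mapsto> A\<^sup>T Q A\<close>; since there are only finitely many eigenvalues, almost every \<open>r\<close>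
  will do (\<open>stein_equation_solvable\<close>). Put \<open>q(x) = x\<^sup>T Q x\<close>, so that
  \<open>q(A x) = r\<^sup>2 q(x) + \<parallel>x\<parallel>\<^sup>2\<close>. Two facts are used.

  \<^item> The form \<open>q\<close> is positive somewhere. Otherwise \<open>- q\<close> would be a Lyapunov function forcing
    \<open>\<parallel>A\<^sup>n\<parallel> = O(r\<^sup>n)\<close>, against the choice of \<open>r\<close> (\<open>stein_form_pos\<close>).

  \<^item> The term \<open>\<parallel>x\<parallel>\<^sup>2\<close> absorbs small perturbations, so \<open>q(B x) \<ge> r\<^sup>2 q(x)\<close> for all \<open>B\<close> near \<open>A\<close>
    (\<open>stein_form_perturb\<close>).

  Starting at a vector where \<open>q\<close> is positive, every product of \<open>n\<close> matrices near \<open>A\<close> multiplies \<open>q\<close>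
  by at least \<open>r\<^bsup>2n\<^esup>\<close>, hence has norm at least a constant times \<open>r\<^sup>n\<close>
  (\<open>lower_spectral_radius_ge_if_form\<close>).
\<close>


section \<open>Operator norm estimates\<close>

lemma norm_matrix_vector_mult_le: "norm (A *v x) \<le> opnorm A * norm x"
  unfolding opnorm_def by (rule onorm) (rule matrix_vector_mul_bounded_linear)

lemma inner_matrix_vector_mult_le: "\<bar>x \<bullet> (Q *v y)\<bar> \<le> opnorm Q * norm x * norm y"
proof -
  have "\<bar>x \<bullet> (Q *v y)\<bar> \<le> norm x * norm (Q *v y)"
    by (rule Cauchy_Schwarz_ineq2)
  also have "\<dots> \<le> norm x * (opnorm Q * norm y)"
    by (intro mult_left_mono norm_matrix_vector_mult_le) auto
  finally show ?thesis by (simp add: mult_ac)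
qed

lemma continuous_opnorm_matprod_const:
  "isCont (\<lambda>B::real^'n^'n. opnorm (matprod (\<lambda>_. B) n)) A"
proof -
  have mult: "(\<lambda>x. f x ** g x) \<midarrow>A\<rightarrow> f A ** g A"
    if "f \<midarrow>A\<rightarrow> f A" "g \<midarrow>A\<rightarrow> g A" for f g :: "real^'n^'n \<Rightarrow> real^'n^'n"
    using that unfolding matrix_matrix_mult_def by (intro tendsto_intros)
  have prod: "(\<lambda>B. matprod (\<lambda>_. B) n) \<midarrow>A\<rightarrow> matprod (\<lambda>_. A) n"
    by (induction n) (auto intro: mult[where f = "\<lambda>x. x"])
  let ?c = "real CARD('n) * real CARD('n)"
  have "\<bar>opnorm X - opnorm Y\<bar> \<le> ?c * norm (X - Y)" for X Y :: "real^'n^'n"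
    using opnorm_triangle[of X 0 Y] opnorm_triangle[of Y 0 X] opnorm_minus_commute[of X Y]
      opnorm_le_norm[of "X - Y"] by simp
  then have "(\<lambda>B. opnorm (matprod (\<lambda>_. B) n) - opnorm (matprod (\<lambda>_. A) n)) \<midarrow>A\<rightarrow> 0"
    using tendsto_mult_right_zero[OF tendsto_norm_zero[OF LIM_zero[OF prod]], of ?c]
    by (rule_tac Lim_null_comparison[rotated]) auto
  then show ?thesis
    unfolding isCont_def by (rule LIM_zero_cancel)
qed


section \<open>Bounds on the lower spectral radius\<close>

lemma lower_spectral_radius_le_min_growth:
  assumes "S \<noteq> {}" "k \<ge> 1"
  shows "lower_spectral_radius S \<le> min_growth S k"
  unfolding lower_spectral_radius_eq_INF[OF assms(1)]
  using assms min_growth_nonneg[OF assms(1)]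
  by (intro cINF_lower bdd_belowI[where m = 0]) auto

lemma lower_spectral_radius_limit: "S \<noteq> {} \<Longrightarrow> min_growth S \<longlonglongrightarrow> lower_spectral_radius S"
  using min_growth_tendsto[of S] lower_spectral_radius_eq_INF[of S] by metis

lemma lower_spectral_radius_le_growth_rate:
  assumes "\<And>i. W i \<in> S" and "0 < M" "0 \<le> r"
    and bound: "\<And>n. opnorm (matprod W n) \<le> M * r ^ n"
  shows "lower_spectral_radius S \<le> r"
proof (rule LIMSEQ_le)
  show "min_growth S \<longlonglongrightarrow> lower_spectral_radius S"
    using assms(1) by (intro lower_spectral_radius_limit) auto
  have "(\<lambda>n. root n M * r) \<longlonglongrightarrow> 1 * r"
    using assms(2) by (intro tendsto_intros LIMSEQ_root_const)
  then show "(\<lambda>n. root n M * r) \<longlonglongrightarrow> r" by simp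
  have "min_growth S n \<le> root n M * r" if "n \<ge> 1" for n
  proof -
    have "min_growth S n \<le> root n (opnorm (matprod W n))"
      using assms(1) by (rule min_growth_le)
    also have "\<dots> \<le> root n (M * r ^ n)"
      using bound that by simp
    also have "\<dots> = root n M * r"
      using that assms(3) by (simp add: real_root_mult real_root_power_cancel)
    finally show ?thesis .
  qed
  then show "\<exists>N. \<forall>n\<ge>N. min_growth S n \<le> root n M * r" by blast
qed

text \<open>
  For a single matrix the infimum over words degenerates to \<open>\<parallel>A\<^sup>n\<parallel>\<^bsup>1/n\<^esup>\<close>, which the constant words in a
  matrix \<open>B\<close> near \<open>A\<close> nearly attain.
\<close>

lemma lower_spectral_radius_upper_semicontinuous:
  fixes A :: "real^'n^'n"
  assumes "lower_spectral_radius {A} < u"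
  obtains d where "d > 0"
    "\<And>B T. B \<in> T \<Longrightarrow> opnorm (B - A) < d \<Longrightarrow> lower_spectral_radius T < u"
proof -
  have "eventually (\<lambda>n. min_growth {A} n < u) sequentially"
    using assms by (intro order_tendstoD(2)[OF lower_spectral_radius_limit]) auto
  then obtain n where n: "n \<ge> 1" "min_growth {A} n < u"
    using eventually_happens'[OF sequentially_bot eventually_conj[OF eventually_ge_at_top[of 1]]]
    by blast
  have "{root n (opnorm (matprod W n)) | W. \<forall>i\<in>{1..n}. W i \<in> {A}}
      = {root n (opnorm (matprod (\<lambda>_. A) n))}"
  proof -
    have const: "matprod W n = matprod (\<lambda>_. A) n" if "\<forall>i\<in>{1..n}. W i \<in> {A}" for W
      using that by (intro matprod_cong) auto
    show ?thesis
    proof (intro subset_antisym subsetI)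
      fix y assume "y \<in> {root n (opnorm (matprod W n)) | W. \<forall>i\<in>{1..n}. W i \<in> {A}}"
      then obtain W where "\<forall>i\<in>{1..n}. W i \<in> {A}" "y = root n (opnorm (matprod W n))"
        by blast
      then show "y \<in> {root n (opnorm (matprod (\<lambda>_. A) n))}"
        by (simp only: const singleton_iff)
    qed blast
  qed
  then have rA: "root n (opnorm (matprod (\<lambda>_. A) n)) < u"
    using n(2) by (simp add: min_growth_def)
  have "isCont (\<lambda>B. root n (opnorm (matprod (\<lambda>_. B) n))) A"
    by (intro continuous_opnorm_matprod_const continuous_intros)
  then have "eventually (\<lambda>B. root n (opnorm (matprod (\<lambda>_. B) n)) < u) (nhds A)"
    using rA by (auto simp: isCont_def tendsto_nhds_iff intro: order_tendstoD)
  then obtain e where e: "e > 0"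
    "\<And>B. dist B A < e \<Longrightarrow> root n (opnorm (matprod (\<lambda>_. B) n)) < u"
    unfolding eventually_nhds_metric by blast
  let ?c = "real CARD('n) * real CARD('n)"
  show thesis
  proof (rule that[of "e / ?c"])
    show "e / ?c > 0" using e(1) by simp
    fix B :: "real^'n^'n" and T
    assume B: "B \<in> T" "opnorm (B - A) < e / ?c"
    have "norm (B - A) \<le> ?c * opnorm (B - A)" by (rule norm_le_opnorm)
    also have "\<dots> < e" using B(2) by (simp add: field_simps)
    finally have "root n (opnorm (matprod (\<lambda>_. B) n)) < u"
      by (intro e(2)) (simp add: dist_norm)
    moreover have "lower_spectral_radius T \<le> min_growth T n"
      using B(1) n(1) by (intro lower_spectral_radius_le_min_growth) auto
    moreover have "min_growth T n \<le> root n (opnorm (matprod (\<lambda>_. B) n))"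
      using B(1) by (intro min_growth_le)
    ultimately show "lower_spectral_radius T < u" by linarith
  qed
qed

text \<open>
  Along any product starting at \<open>x\<close> the form stays at least \<open>r\<^bsup>2n\<^esup>\<close> times its positive initial value,
  while it is at most \<open>\<parallel>Q\<parallel>\<close> times the square of the Euclidean norm; so the norms of the products grow
  at least at rate \<open>r\<close>. The form may be indefinite: the condition on \<open>T\<close> is compatible with contracted directions.
\<close>

lemma lower_spectral_radius_ge_if_form:
  fixes T :: "(real^'n^'n) set"
  assumes "T \<noteq> {}" "0 \<le> r"
    and expand: "\<And>B x. B \<in> T \<Longrightarrow> r\<^sup>2 * (x \<bullet> (Q *v x)) \<le> (B *v x) \<bullet> (Q *v (B *v x))"
    and pos: "x \<bullet> (Q *v x) > 0"
  shows "r \<le> lower_spectral_radius T"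
proof -
  define q where "q y = y \<bullet> (Q *v y)" for y
  have grow: "(r ^ n)\<^sup>2 * q x \<le> q (matprod W n *v x)" if "\<forall>i\<in>{1..n}. W i \<in> T" for W n
    using that
  proof (induction n)
    case (Suc n)
    have "(r ^ Suc n)\<^sup>2 * q x = r\<^sup>2 * ((r ^ n)\<^sup>2 * q x)"
      by (simp add: power_mult_distrib)
    also have "\<dots> \<le> r\<^sup>2 * q (matprod W n *v x)"
      using Suc by (intro mult_left_mono) auto
    also have "\<dots> \<le> q (W (Suc n) *v (matprod W n *v x))"
      unfolding q_def using Suc.prems by (intro expand) auto
    finally show ?case by (simp add: matrix_vector_mul_assoc)
  qed simp
  define D where "D = opnorm Q * (norm x)\<^sup>2"
  have qD: "q y \<le> opnorm Q * (norm y)\<^sup>2" for y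
    using inner_matrix_vector_mult_le[of y Q y] by (simp add: q_def power2_eq_square mult.assoc)
  have D: "D > 0"
    using qD[of x] pos by (simp add: q_def D_def)
  define K where "K = sqrt (q x / D)"
  have K: "K > 0" and K2: "K\<^sup>2 * D = q x"
    using D pos by (simp_all add: K_def q_def)
  have lower: "K * r ^ n \<le> opnorm (matprod W n)" if W: "\<forall>i\<in>{1..n}. W i \<in> T" for W n
  proof (rule power2_le_imp_le)
    have "(K * r ^ n)\<^sup>2 * D = (r ^ n)\<^sup>2 * q x"
      by (simp add: power_mult_distrib flip: K2)
    also have "\<dots> \<le> q (matprod W n *v x)"
      by (rule grow[OF W])
    also have "\<dots> \<le> opnorm Q * (norm (matprod W n *v x))\<^sup>2"
      by (rule qD)
    also have "\<dots> \<le> opnorm Q * (opnorm (matprod W n) * norm x)\<^sup>2"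
      by (intro mult_left_mono power_mono norm_matrix_vector_mult_le) (auto simp: opnorm_nonneg)
    also have "\<dots> = (opnorm (matprod W n))\<^sup>2 * D"
      by (simp add: D_def power_mult_distrib)
    finally show "(K * r ^ n)\<^sup>2 \<le> (opnorm (matprod W n))\<^sup>2"
      using D by simp
  qed (rule opnorm_nonneg)
  obtain B where "B \<in> T" using assms(1) by auto
  have "root n K * r \<le> min_growth T n" if "n \<ge> 1" for n
    unfolding min_growth_def
  proof (rule cInf_greatest)
    show "{root n (opnorm (matprod W n)) | W. \<forall>i\<in>{1..n}. W i \<in> T} \<noteq> {}"
      using \<open>B \<in> T\<close> by (auto intro: exI[of _ "\<lambda>_. B"])
    fix y assume "y \<in> {root n (opnorm (matprod W n)) | W. \<forall>i\<in>{1..n}. W i \<in> T}"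
    then obtain W where W: "\<forall>i\<in>{1..n}. W i \<in> T" "y = root n (opnorm (matprod W n))"
      by blast
    have "root n K * r = root n (K * r ^ n)"
      using that assms(2) by (simp add: real_root_mult real_root_power_cancel)
    also have "\<dots> \<le> y"
      using that lower[OF W(1)] W(2) by simp
    finally show "root n K * r \<le> y" .
  qed
  moreover have "(\<lambda>n. root n K * r) \<longlonglongrightarrow> 1 * r"
    using K by (intro tendsto_intros LIMSEQ_root_const)
  ultimately show ?thesis
    using LIMSEQ_le[OF _ lower_spectral_radius_limit[OF assms(1)]] by auto
qed


section \<open>The Stein equation\<close>

text \<open>Eigenvectors for distinct eigenvalues are linearly independent.\<close>

lemma finite_eigenvalues:
  fixes f :: "'a::euclidean_space \<Rightarrow> 'a"
  assumes "linear f"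
  shows "finite {t. \<exists>v. v \<noteq> 0 \<and> f v = t *\<^sub>R v}" (is "finite ?E")
proof -
  obtain v where v: "\<And>t. t \<in> ?E \<Longrightarrow> v t \<noteq> 0 \<and> f (v t) = t *\<^sub>R v t"
    using bchoice[of ?E "\<lambda>t v. v \<noteq> 0 \<and> f v = t *\<^sub>R v"] by blast
  have scalars: "\<forall>t\<in>F. c t = 0"
    if "finite F" "F \<subseteq> ?E" "(\<Sum>t\<in>F. c t *\<^sub>R v t) = 0" for F c
    using that
  proof (induction F arbitrary: c rule: finite_induct)
    case (insert s F)
    \<comment> \<open>Applying \<open>f - s\<close> kills the term of \<open>s\<close> and rescales the others by \<open>t - s \<noteq> 0\<close>.\<close>
    have "f (\<Sum>t\<in>insert s F. c t *\<^sub>R v t) = (\<Sum>t\<in>insert s F. (c t * t) *\<^sub>R v t)"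
      unfolding linear_sum[OF assms] linear_scale[OF assms]
      using insert.prems(1) v by (intro sum.cong) (force simp: subset_iff)+
    then have "(\<Sum>t\<in>insert s F. (c t * t) *\<^sub>R v t) = 0"
      using insert.prems(2) linear_0[OF assms] by simp
    moreover have "(\<Sum>t\<in>insert s F. (c t * s) *\<^sub>R v t) = s *\<^sub>R (\<Sum>t\<in>insert s F. c t *\<^sub>R v t)"
      by (simp only: scaleR_sum_right scaleR_scaleR mult.commute)
    ultimately have "(\<Sum>t\<in>insert s F. (c t * t) *\<^sub>R v t) - (\<Sum>t\<in>insert s F. (c t * s) *\<^sub>R v t) = 0"
      using insert.prems(2) by simp
    then have "(\<Sum>t\<in>F. (c t * (t - s)) *\<^sub>R v t) = 0"
      using insert.hyps by (simp add: sum_subtractf algebra_simps)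
    then have "\<forall>t\<in>F. c t * (t - s) = 0"
      using insert.prems(1) by (intro insert.IH) auto
    then have F: "\<forall>t\<in>F. c t = 0"
      using insert.hyps(2) by auto
    then have "c s *\<^sub>R v s = 0"
      using insert.prems(2) insert.hyps by simp
    then show ?case
      using F v[of s] insert.prems(1) by auto
  qed simp
  have inj: "inj_on v ?E"
  proof (rule inj_onI)
    fix s t assume "s \<in> ?E" "t \<in> ?E" "v s = v t"
    then have "s *\<^sub>R v s = t *\<^sub>R v s" "v s \<noteq> 0" using v by metis+
    then show "s = t" by simp
  qed
  have "card F \<le> DIM('a)" if F: "finite F" "F \<subseteq> ?E" for F
  proof -
    have injF: "inj_on v F" using inj F(2) by (rule inj_on_subset)
    have "independent (v ` F)"
    proof (rule independent_if_scalars_zero)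
      fix g x assume "(\<Sum>x\<in>v ` F. g x *\<^sub>R x) = 0" "x \<in> v ` F"
      then show "g x = 0"
        using scalars[OF F, of "\<lambda>t. g (v t)"] by (auto simp: sum.reindex[OF injF])
    qed (use F in simp)
    then show ?thesis
      using independent_bound card_image[OF injF] by metis
  qed
  then show ?thesis
    using finite_if_finite_subsets_card_bdd[of ?E "DIM('a)"] by metis
qed

lemma stein_equation_solvable:
  fixes A :: "real^'n^'n"
  assumes "0 \<le> a" "a < b"
  obtains r Q where "a < r" "r < b"
    "\<And>x. (A *v x) \<bullet> (Q *v (A *v x)) = r\<^sup>2 * (x \<bullet> (Q *v x)) + (norm x)\<^sup>2"
proof -
  define L where "L Q = transpose A ** Q ** A" for Q
  have "linear L"
    unfolding L_def
    by (intro linearI) (simp_all add: matrix_eq matrix_vector_mult_add_rdistrib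
      matrix_vector_right_distrib matrix_vector_mult_scaleR
      flip: matrix_vector_mul_assoc scaleR_matrix_vector_assoc)
  let ?E = "{t. \<exists>Q. Q \<noteq> 0 \<and> L Q = t *\<^sub>R Q}"
  have "finite {r \<in> {a<..<b}. r\<^sup>2 \<in> ?E}"
  proof (rule finite_imageD[of power2])
    show "finite (power2 ` {r \<in> {a<..<b}. r\<^sup>2 \<in> ?E})"
      by (rule finite_subset[OF _ finite_eigenvalues[OF \<open>linear L\<close>]]) auto
    show "inj_on power2 {r \<in> {a<..<b}. r\<^sup>2 \<in> ?E}"
      using assms(1) by (auto intro!: inj_onI simp: power2_eq_iff)
  qed
  moreover have "infinite {a<..<b}"
    using assms(2) by simp
  ultimately obtain r where r: "a < r" "r < b" "r\<^sup>2 \<notin> ?E"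
    by (metis (no_types, lifting) finite_subset greaterThanLessThan_iff mem_Collect_eq subsetI)
  have lin: "linear (\<lambda>Q. L Q - r\<^sup>2 *\<^sub>R Q)"
    using \<open>linear L\<close> by (intro linear_compose_sub linear_scaleR) auto
  have "inj (\<lambda>Q. L Q - r\<^sup>2 *\<^sub>R Q)"
    using r(3) by (auto simp: linear_injective_0[OF lin])
  then have "surj (\<lambda>Q. L Q - r\<^sup>2 *\<^sub>R Q)"
    using lin by (intro linear_injective_imp_surjective) simp_all
  then obtain Q where "mat 1 = L Q - r\<^sup>2 *\<^sub>R Q"
    by (rule surjE)
  then have Q: "L Q = r\<^sup>2 *\<^sub>R Q + mat 1" by simp
  have "(A *v x) \<bullet> (Q *v (A *v x)) = r\<^sup>2 * (x \<bullet> (Q *v x)) + (norm x)\<^sup>2" for x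
  proof -
    have "(A *v x) \<bullet> (Q *v (A *v x)) = ((Q *v (A *v x)) v* A) \<bullet> x"
      by (metis dot_lmul_matrix inner_commute)
    also have "\<dots> = x \<bullet> (L Q *v x)"
      by (simp add: L_def inner_commute flip: matrix_vector_mul_assoc)
    also have "\<dots> = r\<^sup>2 * (x \<bullet> (Q *v x)) + (norm x)\<^sup>2"
      unfolding Q by (simp add: matrix_vector_mult_add_rdistrib inner_add_right
        power2_norm_eq_inner scaleR_matrix_vector_assoc[symmetric])
    finally show ?thesis .
  qed
  with r show thesis by (intro that)
qed

text \<open>
  If the form were nowhere positive, its negative would be non-negative, would be multiplied by at
  most \<open>r\<^sup>2\<close> under \<open>A\<close>, and would dominate \<open>\<parallel>x\<parallel>\<^sup>2 / r\<^sup>2\<close> by the Stein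
  equation; hence \<open>\<parallel>A\<^sup>n\<parallel>\<close> would grow at most at rate \<open>r\<close>.
\<close>

lemma stein_form_pos:
  fixes A :: "real^'n^'n"
  assumes "0 < r" "r < lower_spectral_radius {A}"
    and stein: "\<And>x. (A *v x) \<bullet> (Q *v (A *v x)) = r\<^sup>2 * (x \<bullet> (Q *v x)) + (norm x)\<^sup>2"
  obtains x where "x \<bullet> (Q *v x) > 0"
proof (rule ccontr)
  assume "\<not> thesis"
  define p where "p x = - (x \<bullet> (Q *v x))" for x
  have p: "p x \<ge> 0" for x
    using that \<open>\<not> thesis\<close> by (auto simp: p_def not_less[symmetric])
  have step: "p (A *v x) = r\<^sup>2 * p x - (norm x)\<^sup>2" for x
    using stein[of x] by (simp add: p_def)
  have dom: "(norm x)\<^sup>2 \<le> r\<^sup>2 * p x" for x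
    using step[of x] p[of "A *v x"] by simp
  have decay: "p (matprod (\<lambda>_. A) n *v x) \<le> (r ^ n)\<^sup>2 * p x" for n x
  proof (induction n)
    case (Suc n)
    have "p (matprod (\<lambda>_. A) (Suc n) *v x) \<le> r\<^sup>2 * p (matprod (\<lambda>_. A) n *v x)"
      using step[of "matprod (\<lambda>_. A) n *v x"] by (simp add: matrix_vector_mul_assoc)
    also have "\<dots> \<le> r\<^sup>2 * ((r ^ n)\<^sup>2 * p x)"
      using Suc by (intro mult_left_mono) auto
    finally show ?case by (simp add: power_mult_distrib)
  qed simp
  \<comment> \<open>The number \<open>\<parallel>Q\<parallel> + 1\<close> is positive and its square is at least \<open>\<parallel>Q\<parallel>\<close>.\<close>
  define M where "M = r * (opnorm Q + 1)"
  have M: "M > 0"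
    using assms(1) opnorm_nonneg[of Q] by (simp add: M_def)
  have "opnorm (matprod (\<lambda>_. A) n) \<le> M * r ^ n" for n
    unfolding opnorm_def
  proof (rule onorm_le, rule power2_le_imp_le)
    fix x
    have "p x \<le> opnorm Q * (norm x)\<^sup>2"
      using inner_matrix_vector_mult_le[of x Q x] by (simp add: p_def power2_eq_square mult.assoc)
    also have "\<dots> \<le> (opnorm Q + 1)\<^sup>2 * (norm x)\<^sup>2"
      using opnorm_nonneg[of Q] by (intro mult_right_mono) (auto simp: power2_eq_square algebra_simps)
    finally have px: "p x \<le> (opnorm Q + 1)\<^sup>2 * (norm x)\<^sup>2" .
    have "(norm (matprod (\<lambda>_. A) n *v x))\<^sup>2 \<le> r\<^sup>2 * p (matprod (\<lambda>_. A) n *v x)"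
      by (rule dom)
    also have "\<dots> \<le> r\<^sup>2 * ((r ^ n)\<^sup>2 * p x)"
      by (intro mult_left_mono decay) auto
    also have "\<dots> \<le> r\<^sup>2 * ((r ^ n)\<^sup>2 * ((opnorm Q + 1)\<^sup>2 * (norm x)\<^sup>2))"
      by (intro mult_left_mono px) auto
    also have "\<dots> = (M * r ^ n * norm x)\<^sup>2"
      by (simp add: M_def power_mult_distrib)
    finally show "(norm (matprod (\<lambda>_. A) n *v x))\<^sup>2 \<le> (M * r ^ n * norm x)\<^sup>2" .
    show "0 \<le> M * r ^ n * norm x"
      using M assms(1) by simp
  qed
  then have "lower_spectral_radius {A} \<le> r"
    using M assms(1) by (intro lower_spectral_radius_le_growth_rate[where W = "\<lambda>_. A"]) auto
  with assms(2) show False by simp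
qed

lemma stein_form_perturb:
  fixes A :: "real^'n^'n"
  assumes stein: "\<And>x. (A *v x) \<bullet> (Q *v (A *v x)) = r\<^sup>2 * (x \<bullet> (Q *v x)) + (norm x)\<^sup>2"
  obtains d where "d > 0"
    "\<And>B x. opnorm (B - A) < d \<Longrightarrow> r\<^sup>2 * (x \<bullet> (Q *v x)) \<le> (B *v x) \<bullet> (Q *v (B *v x))"
proof -
  \<comment> \<open>With \<open>E = B - A\<close>, the three terms of \<open>q(A x + E x) - q(A x)\<close> that contain \<open>E\<close> sum to at most
    \<open>\<parallel>Q\<parallel> (2 \<parallel>A\<parallel> + \<parallel>E\<parallel>) \<parallel>E\<parallel> \<parallel>x\<parallel>\<^sup>2\<close> in absolute value. The bound on
    \<open>\<parallel>E\<parallel>\<close> below gives \<open>\<parallel>E\<parallel> \<le> 1\<close> and then makes this at most \<open>\<parallel>x\<parallel>\<^sup>2\<close>.\<close>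
  define C where "C = opnorm Q * (2 * opnorm A + 1)"
  have C: "C \<ge> 0"
    by (simp add: C_def opnorm_nonneg)
  show thesis
  proof (rule that[of "1 / (1 + C)"])
    show "1 / (1 + C) > 0" using C by simp
    fix B :: "real^'n^'n" and x :: "real^'n"
    assume B: "opnorm (B - A) < 1 / (1 + C)"
    define E where "E = B - A"
    define e where "e = opnorm E"
    have e: "0 \<le> e" "e * (1 + C) \<le> 1"
      using B C by (simp_all add: e_def E_def opnorm_nonneg field_simps)
    have e1: "e \<le> 1"
      using e C mult_left_mono[of 1 "1 + C" e] by simp
    define u where "u = A *v x"
    define w where "w = E *v x"
    have Bx: "B *v x = u + w"
      by (simp add: u_def w_def E_def matrix_vector_mult_diff_rdistrib)
    have u: "norm u \<le> opnorm A * norm x" and w: "norm w \<le> e * norm x"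
      by (simp_all add: u_def w_def e_def norm_matrix_vector_mult_le)
    have nn: "0 \<le> opnorm Q" "0 \<le> opnorm A" by (rule opnorm_nonneg)+
    have "\<bar>u \<bullet> (Q *v w)\<bar> \<le> opnorm Q * norm u * norm w"
      by (rule inner_matrix_vector_mult_le)
    also have "\<dots> \<le> opnorm Q * (opnorm A * norm x) * (e * norm x)"
      using u w e nn by (intro mult_mono mult_nonneg_nonneg) auto
    finally have uw: "\<bar>u \<bullet> (Q *v w)\<bar> \<le> opnorm Q * opnorm A * e * (norm x)\<^sup>2"
      by (simp add: power2_eq_square mult_ac)
    have "\<bar>w \<bullet> (Q *v u)\<bar> \<le> opnorm Q * norm w * norm u"
      by (rule inner_matrix_vector_mult_le)
    also have "\<dots> \<le> opnorm Q * (e * norm x) * (opnorm A * norm x)"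
      using u w e nn by (intro mult_mono mult_nonneg_nonneg) auto
    finally have wu: "\<bar>w \<bullet> (Q *v u)\<bar> \<le> opnorm Q * opnorm A * e * (norm x)\<^sup>2"
      by (simp add: power2_eq_square mult_ac)
    have "\<bar>w \<bullet> (Q *v w)\<bar> \<le> opnorm Q * norm w * norm w"
      by (rule inner_matrix_vector_mult_le)
    also have "\<dots> \<le> opnorm Q * (1 * norm x) * (e * norm x)"
      using order_trans[OF w mult_right_mono[OF e1]] w e nn
      by (intro mult_mono mult_nonneg_nonneg) auto
    finally have ww: "\<bar>w \<bullet> (Q *v w)\<bar> \<le> opnorm Q * e * (norm x)\<^sup>2"
      by (simp add: power2_eq_square mult_ac)
    have "\<bar>u \<bullet> (Q *v w)\<bar> + \<bar>w \<bullet> (Q *v u)\<bar> + \<bar>w \<bullet> (Q *v w)\<bar> \<le> e * C * (norm x)\<^sup>2"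
      using uw wu ww by (simp add: C_def algebra_simps)
    also have "\<dots> \<le> 1 * (norm x)\<^sup>2"
      using e by (intro mult_right_mono) (auto simp: algebra_simps)
    finally have "- (norm x)\<^sup>2 \<le> u \<bullet> (Q *v w) + w \<bullet> (Q *v u) + w \<bullet> (Q *v w)"
      by linarith
    moreover have "(B *v x) \<bullet> (Q *v (B *v x))
        = u \<bullet> (Q *v u) + (u \<bullet> (Q *v w) + w \<bullet> (Q *v u) + w \<bullet> (Q *v w))"
      by (simp add: Bx matrix_vector_right_distrib inner_add_left inner_add_right)
    moreover have "u \<bullet> (Q *v u) = r\<^sup>2 * (x \<bullet> (Q *v x)) + (norm x)\<^sup>2"
      unfolding u_def by (rule stein)
    ultimately show "r\<^sup>2 * (x \<bullet> (Q *v x)) \<le> (B *v x) \<bullet> (Q *v (B *v x))"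
      by linarith
  qed
qed


section \<open>Continuity at singletons\<close>

lemma lower_spectral_radius_lower_semicontinuous:
  fixes A :: "real^'n^'n"
  assumes "a < lower_spectral_radius {A}"
  obtains d where "d > 0"
    "\<And>T. T \<noteq> {} \<Longrightarrow> (\<And>B. B \<in> T \<Longrightarrow> opnorm (B - A) < d) \<Longrightarrow> a < lower_spectral_radius T"
proof (cases "a < 0")
  case True
  show thesis
  proof (rule that[of 1])
    fix T :: "(real^'n^'n) set" assume "T \<noteq> {}"
    then show "a < lower_spectral_radius T"
      using True lower_spectral_radius_nonneg[of T] by simp
  qed simp
next
  case False
  then have "0 \<le> a" by simp
  obtain r Q where r: "a < r" "r < lower_spectral_radius {A}"
    and stein: "\<And>x. (A *v x) \<bullet> (Q *v (A *v x)) = r\<^sup>2 * (x \<bullet> (Q *v x)) + (norm x)\<^sup>2"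
    by (rule stein_equation_solvable[OF \<open>0 \<le> a\<close> assms, of A]) (rule that)
  have "0 < r" using r(1) \<open>0 \<le> a\<close> by simp
  obtain x where x: "x \<bullet> (Q *v x) > 0"
    using stein_form_pos[OF \<open>0 < r\<close> r(2) stein] .
  obtain d where d: "d > 0"
    "\<And>B x. opnorm (B - A) < d \<Longrightarrow> r\<^sup>2 * (x \<bullet> (Q *v x)) \<le> (B *v x) \<bullet> (Q *v (B *v x))"
    by (rule stein_form_perturb[OF stein]) (rule that)
  show thesis
  proof (rule that[OF d(1)])
    fix T assume "T \<noteq> {}" "\<And>B. B \<in> T \<Longrightarrow> opnorm (B - A) < d"
    then have "r \<le> lower_spectral_radius T"
      using \<open>0 < r\<close> by (intro lower_spectral_radius_ge_if_form[OF _ _ d(2) x]) auto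
    with r(1) show "a < lower_spectral_radius T" by simp
  qed
qed

theorem corollary1p2:
  fixes S :: "(real^'n^'n) set"
  assumes "S \<in> K_GL" and "is_singleton S"
  shows "topcontinuous_at (Metric_space.mtopology K_GL hausdorff_dist)
           (top_of_set {0..}) lower_spectral_radius S"
proof -
  interpret H: Metric_space "K_GL :: (real^'n^'n) set set" hausdorff_dist
    by (rule Metric_space_hausdorff_dist)
  obtain A where S: "S = {A}"
    using assms(2) by (rule is_singletonE)
  show ?thesis
    unfolding topcontinuous_at_def
  proof (intro conjI allI impI)
    show "S \<in> topspace H.mtopology"
      using assms(1) by simp
    show "lower_spectral_radius \<in> topspace H.mtopology \<rightarrow> topspace (top_of_set {0..})"
      using lower_spectral_radius_nonneg unfolding H.topspace_mtopology topspace_euclidean_subtopology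
      by (auto simp: K_GL_def)
    fix V assume "openin (top_of_set {0..}) V \<and> lower_spectral_radius S \<in> V"
    then obtain e where e: "e > 0"
      "\<And>y. y \<ge> 0 \<Longrightarrow> \<bar>y - lower_spectral_radius S\<bar> < e \<Longrightarrow> y \<in> V"
      unfolding openin_euclidean_subtopology_iff by (auto simp: dist_real_def)
    obtain d1 where d1: "d1 > 0"
      "\<And>B T. B \<in> T \<Longrightarrow> opnorm (B - A) < d1 \<Longrightarrow>
        lower_spectral_radius T < lower_spectral_radius {A} + e"
      using lower_spectral_radius_upper_semicontinuous[of A "lower_spectral_radius {A} + e"] e(1)
      by auto
    obtain d2 where d2: "d2 > 0"
      "\<And>T. T \<noteq> {} \<Longrightarrow> (\<And>B. B \<in> T \<Longrightarrow> opnorm (B - A) < d2) \<Longrightarrow>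
        lower_spectral_radius {A} - e < lower_spectral_radius T"
      using lower_spectral_radius_lower_semicontinuous[of "lower_spectral_radius {A} - e" A] e(1)
      by auto
    have "lower_spectral_radius T \<in> V" if T: "T \<in> H.mball S (min d1 d2)" for T
    proof -
      have near: "opnorm (B - A) < min d1 d2" if "B \<in> T" for B
        using T that S hausdorff_dist_lessD[of T S B "min d1 d2"]
        by (auto simp: hausdorff_dist_commute)
      have "T \<in> K_GL" using T by simp
      then have "T \<noteq> {}" by (simp add: K_GL_def)
      then obtain B where "B \<in> T" by auto
      have "lower_spectral_radius T < lower_spectral_radius {A} + e"
        using d1(2)[OF \<open>B \<in> T\<close>] near[OF \<open>B \<in> T\<close>] by simp
      moreover have "lower_spectral_radius {A} - e < lower_spectral_radius T"
        using d2(2)[OF \<open>T \<noteq> {}\<close>] near by simp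
      ultimately show ?thesis
        using \<open>T \<noteq> {}\<close> S by (intro e(2)) (auto simp: lower_spectral_radius_nonneg)
    qed
    then show "\<exists>U. openin H.mtopology U \<and> S \<in> U \<and> (\<forall>T\<in>U. lower_spectral_radius T \<in> V)"
      using assms(1) d1(1) d2(1) by (intro exI[of _ "H.mball S (min d1 d2)"]) auto
  qed
qed

end
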